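(* Let $\gamma'\in(0,2]$ and $\gamma\in(0,1]$ with $\gamma'\le2\gamma$, let $\lambda>0$ and $b\in(-1,1)$. Let $S_\gamma$ be a (positive) $\gamma$-stable random variable with Laplace transform $\mathrm{E}\,e^{-uS_\gamma}=\exp\{-u^{\gamma}\}$. Then $$\mathcal{T}\mathrm{PDS}(\gamma',\lambda,b)\stackrel{d}{=}\mathcal{T}\mathrm{PDS}\left(\gamma'/\gamma,\ \lambda^{1/\gamma}S_\gamma,\ b\right).$$
   Context: For $\gamma\in(0,2]$, $\lambda>0$, $b\in(-1,1)$, $\mathcal{T}\mathrm{PDS}(\gamma,\lambda,b)$ denotes the distribution on $\mathbb{N}_0$ with probability generating function, for $z\in[0,1]$, $$\mathcal{P}(z)=\exp\left\{-\lambda\left(\arccos\frac{(1+b)z-2b}{2-(1+b)z}\right)^{\gamma}\right\}.$$ When the parameter $\lambda$ is replaced by a positive random variable $\Lambda$, $\mathcal{T}\mathrm{PDS}(\gamma,\Lambda,b)$ denotes the mixture: conditionally on $\Lambda=\ell$ the distribution is $\mathcal{T}\mathrm{PDS}(\gamma,\ell,b)$. For $\gamma=1$, $S_1=1$ almost surely. *)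

theory Defs
  imports "HOL-Probability.Probability"
begin

definition pgf :: "nat pmf \<Rightarrow> real \<Rightarrow> real" where
  "pgf p z = measure_pmf.expectation p (\<lambda>n. z ^ n)"

text \<open>
  Here the first parameter \<open>g\<close> is the exponent and \<open>l\<close> the rate. A probability generating
  function on \<open>[0,1]\<close> determines the distribution, and for \<open>0 < g \<le> 2\<close>, \<open>l > 0\<close>,
  \<open>-1 < b < 1\<close> a distribution with this generating function exists; outside that range the
  value may be arbitrary. At \<open>z = 1\<close> the base of the power is \<open>arccos 1 = 0\<close>, where
  \<open>0 powr g = 0\<close>, as it should be.
\<close>

definition TPDS :: "real \<Rightarrow> real \<Rightarrow> real \<Rightarrow> nat pmf" where
  "TPDS g l b = (THE p. \<forall>z\<in>{0..1}. pgf p z =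
     exp (- l * (arccos (((1 + b) * z - 2 * b) / (2 - (1 + b) * z))) powr g))"

text \<open>
  The mixture obtained by replacing the rate with a random variable \<open>L\<close> on the probability
  space \<open>M\<close>: draw \<open>\<omega>\<close> from \<open>M\<close>, then draw from the distribution with rate \<open>L \<omega>\<close>.
\<close>

definition TPDS_mixture :: "'a measure \<Rightarrow> real \<Rightarrow> ('a \<Rightarrow> real) \<Rightarrow> real \<Rightarrow> nat measure" where
  "TPDS_mixture M g L b = M \<bind> (\<lambda>\<omega>. measure_pmf (TPDS g (L \<omega>) b))"

end

theory Submission
  imports Defs
begin

text \<open>
  Write \<open>\<theta>\<close> for the arccosine in the generating function and \<open>g = \<gamma>' / \<gamma>\<close>. Conditionally on
  the rate \<open>L = l powr (1 / \<gamma>) * S\<close> the mixture has generating function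
  \<open>exp (- L * \<theta> powr g)\<close>, and averaging over \<open>S\<close> evaluates the Laplace transform of \<open>S\<close> at
  \<open>u = l powr (1 / \<gamma>) * \<theta> powr g\<close>. The result is \<open>exp (- (u powr \<gamma>))\<close>, that is
  \<open>exp (- l * \<theta> powr \<gamma>')\<close>, the generating function of the left-hand side; a generating function
  determines its law (\<open>pmf_eqI_pgf\<close>).

  The computation rests on the existence of the laws being mixed, without which the definite
  description \<open>TPDS\<close> says nothing (\<open>is_pgf_TPDS\<close>). The half-angle formula gives
  \<open>\<theta> = 2 * arctan (sqrt t)\<close> with \<open>t = a * (1 - z)\<close> and \<open>a = (1 + b) / (1 - b)\<close>. The function
  \<open>(arctan (sqrt t))\<^sup>2\<close> is a Bernstein function of \<open>t\<close>: its derivative is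
  \<open>arctan (sqrt t) / sqrt t\<close> times \<open>1 / (1 + t)\<close>, and the first factor is the integral of
  \<open>1 / (1 + t * u\<^sup>2)\<close> over \<open>u\<close> in \<open>[0,1]\<close>. In terms of \<open>z\<close> this means that
  \<open>\<theta>\<^sup>2\<close> is a constant multiple of \<open>1 - y(z)\<close> for a generating function \<open>y\<close>
  (\<open>is_pgf_arctan_squared\<close>). Since \<open>g / 2 \<le> 1\<close>, also \<open>1 - (1 - y) powr (g / 2)\<close> is a generating
  function, by composition with Sibuya's law, and composition with a Poisson law gives
  \<open>exp (- l * \<theta> powr g)\<close>.

  The mixture is a Giry monad bind, so the kernel has to be measurable. The coefficients are
  successive limits of expressions in the generating function at the points \<open>1 / (m + 1)\<close>
  (\<open>pmf_as_limit_of_pgf\<close>), so they inherit measurability from it; the same limits yield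
  uniqueness.
\<close>

section \<open>A generating function on the unit interval determines its law\<close>

lemma integrable_pgf:
  assumes "z \<in> {0..1}"
  shows "integrable (measure_pmf p) (\<lambda>n. z ^ n :: real)"
  using assms
  by (intro measure_pmf.integrable_const_bound[where B = 1] AE_pmfI) (auto simp: power_le_one)

lemma pgf_nn_integral:
  assumes "z \<in> {0..1}"
  shows "ennreal (pgf p z) = (\<integral>\<^sup>+n. ennreal (z ^ n) \<partial>measure_pmf p)"
  unfolding pgf_def using assms integrable_pgf[OF assms]
  by (subst nn_integral_eq_integral) auto

lemma pgf_nonneg: "z \<in> {0..1} \<Longrightarrow> 0 \<le> pgf p z"
  unfolding pgf_def by (rule integral_nonneg_AE) auto

lemma pgf_le_1: "z \<in> {0..1} \<Longrightarrow> pgf p z \<le> 1"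
  unfolding pgf_def using integrable_pgf[of z p]
  by (intro measure_pmf.integral_le_const AE_pmfI) (auto simp: power_le_one)

lemma pgf_1: "pgf p 1 = 1"
  by (simp add: pgf_def)

lemma pgf_sums:
  assumes "z \<in> {0..1}"
  shows "(\<lambda>n. pmf p n * z ^ n) sums pgf p z"
proof -
  have "integrable (count_space UNIV) (\<lambda>n. pmf p n * z ^ n)"
    using integrable_pgf[OF assms, of p]
    by (subst (asm) measure_pmf_eq_density, subst (asm) integrable_density) auto
  moreover have "pgf p z = (\<integral>n. pmf p n * z ^ n \<partial>count_space UNIV)"
    unfolding pgf_def measure_pmf_eq_density
    by (subst integral_density) auto
  ultimately show ?thesis
    using sums_integral_count_space_nat by metis
qed

text \<open>
  The tail of the series beyond the first \<open>n\<close> coefficients is \<open>z ^ n\<close> times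
  \<open>pmf p n + O(z)\<close>, because all later coefficients together have mass at most one.
\<close>

lemma pmf_as_limit_of_pgf:
  "(\<lambda>m. (pgf p (1 / real (Suc m)) - (\<Sum>k<n. pmf p k * (1 / real (Suc m)) ^ k))
          / (1 / real (Suc m)) ^ n) \<longlonglongrightarrow> pmf p n"
proof -
  have bounds: "pmf p n \<le> (pgf p z - (\<Sum>k<n. pmf p k * z ^ k)) / z ^ n
      \<and> (pgf p z - (\<Sum>k<n. pmf p k * z ^ k)) / z ^ n \<le> pmf p n + z"
    if z: "0 < z" "z \<le> 1" for z
  proof -
    have s: "(\<lambda>k. pmf p k * z ^ k) sums pgf p z" using z by (intro pgf_sums) auto
    have m: "pmf p sums 1" using pgf_sums[of 1 p] by (simp add: pgf_1)
    have tail: "(\<lambda>k. pmf p (k + Suc n) * z ^ (k + Suc n)) sums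
        (pgf p z - (\<Sum>k<Suc n. pmf p k * z ^ k))"
      by (subst sums_iff_shift) (use s in auto)
    have mass: "(\<lambda>k. pmf p (k + Suc n)) sums (1 - (\<Sum>k<Suc n. pmf p k))"
      by (subst sums_iff_shift) (use m in auto)
    have lo: "0 \<le> pgf p z - (\<Sum>k<Suc n. pmf p k * z ^ k)"
      by (rule sums_le[OF _ sums_zero tail]) (use z in auto)
    have "pgf p z - (\<Sum>k<Suc n. pmf p k * z ^ k) \<le> (1 - (\<Sum>k<Suc n. pmf p k)) * z ^ Suc n"
    proof (rule sums_le[OF _ tail sums_mult2[OF mass]])
      show "pmf p (k + Suc n) * z ^ (k + Suc n) \<le> pmf p (k + Suc n) * z ^ Suc n" for k
        using z by (intro mult_left_mono power_decreasing) auto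
    qed
    also have "\<dots> \<le> 1 * z ^ Suc n"
      using z sum_nonneg[of "{..<Suc n}" "pmf p"] by (intro mult_right_mono) simp_all
    finally have hi: "pgf p z - (\<Sum>k<Suc n. pmf p k * z ^ k) \<le> z ^ Suc n" by simp
    show ?thesis
      using lo hi z by (auto simp: field_simps)
  qed
  have "(\<lambda>m. pmf p n + 1 / real (Suc m)) \<longlonglongrightarrow> pmf p n + 0"
    by (intro tendsto_intros LIMSEQ_Suc[OF lim_1_over_n])
  then have up: "(\<lambda>m. pmf p n + 1 / real (Suc m)) \<longlonglongrightarrow> pmf p n" by simp
  show ?thesis
    using bounds
    by (intro tendsto_sandwich[OF always_eventually always_eventually tendsto_const up]) auto
qed

lemma pmf_eqI_pgf:
  assumes "\<And>z. z \<in> {0..1} \<Longrightarrow> pgf p z = pgf q z"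
  shows "p = q"
proof (rule pmf_eqI)
  fix n
  show "pmf p n = pmf q n"
  proof (induction n rule: less_induct)
    case (less n)
    have "(\<lambda>m. (pgf p (1 / real (Suc m)) - (\<Sum>k<n. pmf p k * (1 / real (Suc m)) ^ k))
          / (1 / real (Suc m)) ^ n) =
        (\<lambda>m. (pgf q (1 / real (Suc m)) - (\<Sum>k<n. pmf q k * (1 / real (Suc m)) ^ k))
          / (1 / real (Suc m)) ^ n)"
      using less by (simp add: assms)
    then show ?case
      using LIMSEQ_unique[OF pmf_as_limit_of_pgf[of p n]] pmf_as_limit_of_pgf[of q n] by (simp only:)
  qed
qed

lemma measurable_pmf_of_measurable_pgf:
  assumes "\<And>z. z \<in> {0..1} \<Longrightarrow> (\<lambda>\<omega>. pgf (P \<omega>) z) \<in> borel_measurable M"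
  shows "(\<lambda>\<omega>. pmf (P \<omega>) n) \<in> borel_measurable M"
proof (induction n rule: less_induct)
  case (less n)
  show ?case
  proof (rule borel_measurable_LIMSEQ_real[OF pmf_as_limit_of_pgf])
    fix m
    have "(\<lambda>\<omega>. pgf (P \<omega>) (1 / real (Suc m))) \<in> borel_measurable M"
      by (rule assms) auto
    then show "(\<lambda>\<omega>. (pgf (P \<omega>) (1 / real (Suc m))
        - (\<Sum>k<n. pmf (P \<omega>) k * (1 / real (Suc m)) ^ k)) / (1 / real (Suc m)) ^ n)
        \<in> borel_measurable M"
      using less by (intro borel_measurable_divide borel_measurable_diff borel_measurable_sum
          borel_measurable_times borel_measurable_const) auto
  qed
qed

lemma measurable_pmf_kernel:
  fixes P :: "'a \<Rightarrow> nat pmf"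
  assumes "\<And>z. z \<in> {0..1} \<Longrightarrow> (\<lambda>\<omega>. pgf (P \<omega>) z) \<in> borel_measurable M"
  shows "(\<lambda>\<omega>. measure_pmf (P \<omega>)) \<in> measurable M (subprob_algebra (count_space UNIV))"
proof (rule measurable_subprob_algebra)
  fix A :: "nat set"
  have "emeasure (measure_pmf (P \<omega>)) A = (\<Sum>n. ennreal (pmf (P \<omega>) n) * indicator A n)" for \<omega>
    unfolding measure_pmf_eq_density
    by (simp add: emeasure_density nn_integral_count_space_nat)
  then show "(\<lambda>\<omega>. emeasure (measure_pmf (P \<omega>)) A) \<in> borel_measurable M"
    using measurable_pmf_of_measurable_pgf[of P M, OF assms]
    by (auto intro!: borel_measurable_suminf_order)
qed (auto intro: measure_pmf.subprob_space_axioms)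

section \<open>Closure properties of the class of generating functions\<close>

definition is_pgf :: "(real \<Rightarrow> real) \<Rightarrow> bool" where
  "is_pgf f \<longleftrightarrow> (\<exists>p. \<forall>z\<in>{0..1}. pgf p z = f z)"

lemma is_pgf_bounds:
  assumes "is_pgf f" "z \<in> {0..1}"
  shows "0 \<le> f z \<and> f z \<le> 1"
proof -
  obtain p where "pgf p z = f z" using assms unfolding is_pgf_def by blast
  then show ?thesis using pgf_nonneg[OF assms(2), of p] pgf_le_1[OF assms(2), of p] by simp
qed

lemma is_pgf_cong: "is_pgf f \<Longrightarrow> (\<And>z. z \<in> {0..1} \<Longrightarrow> f z = g z) \<Longrightarrow> is_pgf g"
  unfolding is_pgf_def by auto

text \<open>
  Continuity at \<open>1\<close> transfers the total mass: finite partial sums of the coefficients are limits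
  of partial sums of the series as \<open>z\<close> increases to \<open>1\<close>, hence at most \<open>f 1\<close>; conversely
  the series at \<open>z < 1\<close> is at most the sum of the coefficients.
\<close>

lemma is_pgf_power_series:
  assumes nonneg: "\<And>n. 0 \<le> c n"
    and series: "\<And>z. 0 \<le> z \<Longrightarrow> z < 1 \<Longrightarrow> (\<lambda>n. c n * z ^ n) sums f z"
    and cont: "continuous_on {0..1} f" and f1: "f 1 = 1"
  shows "is_pgf f"
proof -
  have ev: "\<forall>\<^sub>F z::real in at_left 1. 0 \<le> z \<and> z < 1"
    unfolding eventually_at_left_field by (intro exI[of _ 0]) auto
  have lim: "(f \<longlongrightarrow> 1) (at_left 1)"
    using continuous_on_tendsto_compose[OF cont, of "\<lambda>x. x" 1 "at_left 1"] f1
      eventually_mono[OF ev, of "\<lambda>x. x \<in> {0..1}"]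
    by (simp add: tendsto_ident_at)
  have part: "(\<Sum>n<N. c n) \<le> 1" for N
  proof (rule tendsto_le[OF _ lim])
    show "((\<lambda>z. \<Sum>n<N. c n * z ^ n) \<longlongrightarrow> (\<Sum>n<N. c n)) (at_left 1)"
      by (auto intro!: tendsto_eq_intros)
    show "\<forall>\<^sub>F z in at_left 1. (\<Sum>n<N. c n * z ^ n) \<le> f z"
      using ev
    proof eventually_elim
      case (elim z)
      then show ?case
        using series[of z] nonneg 
        by (subst sums_unique[of _ "f z"]) (auto intro!: sum_le_suminf dest: sums_summable)
    qed
  qed auto
  have sm: "summable c"
    by (rule summableI_nonneg_bounded[OF nonneg part])
  have "suminf c \<le> 1"
    by (rule suminf_le_const[OF sm part])
  moreover have "1 \<le> suminf c"
  proof (rule tendsto_upperbound[OF lim])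
    show "\<forall>\<^sub>F z in at_left 1. f z \<le> suminf c"
      using ev
    proof eventually_elim
      case (elim z)
      then show ?case
        using nonneg
        by (intro sums_le[OF _ series summable_sums[OF sm]]) (auto intro!: mult_left_le power_le_one)
    qed
  qed auto
  ultimately have c1: "suminf c = 1" by simp
  have "(\<integral>\<^sup>+n. ennreal (c n) \<partial>count_space UNIV) = 1"
    using nonneg c1 sm by (simp add: nn_integral_count_space_nat suminf_ennreal2)
  then have pmf: "pmf (embed_pmf c) n = c n" for n
    using nonneg by (intro pmf_embed_pmf) auto
  have "pgf (embed_pmf c) z = f z" if "z \<in> {0..1}" for z
  proof (cases "z = 1")
    case False
    then have "(\<lambda>n. c n * z ^ n) sums f z" using that by (intro series) auto
    moreover have "(\<lambda>n. c n * z ^ n) sums pgf (embed_pmf c) z"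
      using pgf_sums[OF that, of "embed_pmf c"] by (simp add: pmf)
    ultimately show ?thesis by (metis sums_unique2)
  qed (simp add: f1 pgf_1)
  then show ?thesis unfolding is_pgf_def by blast
qed

lemma is_pgf_const_1: "is_pgf (\<lambda>z. 1)"
  unfolding is_pgf_def pgf_def by (intro exI[of _ "return_pmf 0"]) auto

lemma is_pgf_mult:
  assumes "is_pgf f" "is_pgf g"
  shows "is_pgf (\<lambda>z. f z * g z)"
proof -
  obtain p q where p: "\<And>z. z \<in> {0..1} \<Longrightarrow> pgf p z = f z" and q: "\<And>z. z \<in> {0..1} \<Longrightarrow> pgf q z = g z"
    using assms unfolding is_pgf_def by blast
  have "pgf (bind_pmf p (\<lambda>m. map_pmf ((+) m) q)) z = f z * g z" if z: "z \<in> {0..1}" for z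
  proof -
    have "ennreal (pgf (bind_pmf p (\<lambda>m. map_pmf ((+) m) q)) z) = ennreal (pgf p z) * ennreal (pgf q z)"
      using z by (simp add: pgf_nn_integral power_add ennreal_mult nn_integral_cmult nn_integral_multc)
    then show ?thesis
      using z by (simp add: p[symmetric] q[symmetric] pgf_nonneg flip: ennreal_mult)
  qed
  then show ?thesis unfolding is_pgf_def by blast
qed

text \<open>
  The composition is the generating function of the sum of a random number, with generating
  function \<open>f\<close>, of independent variables with generating function \<open>g\<close>.
\<close>

lemma is_pgf_compose:
  assumes "is_pgf f" "is_pgf g"
  shows "is_pgf (\<lambda>z. f (g z))"
proof -
  have "is_pgf (\<lambda>z. g z ^ k)" for k
    by (induction k) (auto intro: is_pgf_const_1 is_pgf_mult assms)
  then obtain Q where Q: "\<And>k z. z \<in> {0..1} \<Longrightarrow> pgf (Q k) z = g z ^ k"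
    unfolding is_pgf_def by metis
  obtain p where p: "\<And>z. z \<in> {0..1} \<Longrightarrow> pgf p z = f z"
    using assms unfolding is_pgf_def by blast
  have "pgf (bind_pmf p Q) z = f (g z)" if z: "z \<in> {0..1}" for z
  proof -
    have g: "g z \<in> {0..1}" using is_pgf_bounds[OF assms(2) z] by auto
    have "ennreal (pgf (bind_pmf p Q) z) = (\<integral>\<^sup>+k. ennreal (pgf (Q k) z) \<partial>p)"
      using z by (simp add: pgf_nn_integral)
    also have "\<dots> = ennreal (pgf p (g z))"
      using z g by (simp add: Q pgf_nn_integral)
    finally show ?thesis
      using z g by (simp add: p[symmetric] pgf_nonneg)
  qed
  then show ?thesis unfolding is_pgf_def by blast
qed

section \<open>Power series with nonnegative coefficients\<close>

lemma is_pgf_exp: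
  fixes r :: real
  assumes "0 \<le> r"
  shows "is_pgf (\<lambda>z. exp (- r * (1 - z)))"
proof (rule is_pgf_power_series)
  show "0 \<le> exp (- r) * (r ^ n / fact n)" for n using assms by simp
  fix z :: real
  have "(\<lambda>n. exp (- r) * ((r * z) ^ n /\<^sub>R fact n)) sums (exp (- r) * exp (r * z))"
    by (intro sums_mult exp_converges)
  also have "exp (- r) * exp (r * z) = exp (- r * (1 - z))"
    by (simp add: algebra_simps flip: exp_add)
  finally show "(\<lambda>n. exp (- r) * (r ^ n / fact n) * z ^ n) sums exp (- r * (1 - z))"
    by (simp add: power_mult_distrib field_simps)
qed (auto intro!: continuous_intros)

lemma is_pgf_geometric:
  fixes c :: real
  assumes "0 \<le> c" "c < 1"
  shows "is_pgf (\<lambda>z. (1 - c) / (1 - c * z))"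
proof (rule is_pgf_power_series)
  have lt: "c * z < 1" if "0 \<le> z" "z \<le> 1" for z
    using assms that mult_left_le[of z c] by simp
  show "0 \<le> (1 - c) * c ^ n" for n using assms by simp
  show "(\<lambda>n. (1 - c) * c ^ n * z ^ n) sums ((1 - c) / (1 - c * z))" if "0 \<le> z" "z < 1" for z
    using sums_mult[OF geometric_sums[of "c * z"], of "1 - c"] assms that lt[of z]
    by (simp add: power_mult_distrib mult.assoc)
  show "continuous_on {0..1} (\<lambda>z. (1 - c) / (1 - c * z))"
    using lt by (intro continuous_intros) fastforce
qed (use assms in auto)

text \<open>
  The binomial series has \<open>r\<close> as coefficient of \<open>z\<close>, and the ratio of the coefficients of
  \<open>z ^ (n + 1)\<close> and \<open>z ^ n\<close> is \<open>(n - r) / (n + 1)\<close>, which is nonnegative for \<open>n \<ge> 1\<close>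
  because \<open>r \<le> 1\<close>.
\<close>

lemma is_pgf_sibuya:
  fixes r :: real
  assumes "0 < r" "r \<le> 1"
  shows "is_pgf (\<lambda>z. 1 - (1 - z) powr r)"
proof (rule is_pgf_power_series)
  define d where "d n = (-1) ^ n * (r gchoose n)" for n
  have step: "d (Suc n) = d n * ((real n - r) / (real n + 1))" for n
  proof -
    have "(r gchoose Suc n) = - ((r gchoose n) * ((real n - r) / (real n + 1)))"
      using gbinomial_mult_1[of r n] by (simp add: field_simps)
    then show ?thesis by (simp add: d_def)
  qed
  have neg: "d (Suc n) \<le> 0" for n
  proof (induction n)
    case 0
    then show ?case using assms by (simp add: d_def)
  next
    case (Suc n)
    have "0 \<le> (real (Suc n) - r) / (real (Suc n) + 1)" using assms by simp
    then show ?case using Suc step[of "Suc n"] by (metis mult_nonpos_nonneg)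
  qed
  define c where "c n = (if n = 0 then 1 else 0) - d n" for n
  show "0 \<le> c n" for n
    using neg[of "n - 1"] by (cases n) (auto simp: c_def d_def)
  fix z :: real
  assume z: "0 \<le> z" "z < 1"
  have "(\<lambda>n. (r gchoose n) * (- z) ^ n) sums (1 + - z) powr r"
    using z by (intro gen_binomial_real) auto
  also have "(\<lambda>n. (r gchoose n) * (- z) ^ n) = (\<lambda>n. d n * z ^ n)"
    by (auto simp: d_def power_minus[of z])
  finally have "(\<lambda>n. (if n = 0 then 1 else 0) - d n * z ^ n) sums (1 - (1 + - z) powr r)"
    using sums_single[of 0 "\<lambda>n. 1 :: real"] by (intro sums_diff) auto
  moreover have "(\<lambda>n. (if n = 0 then 1 else 0) - d n * z ^ n) = (\<lambda>n. c n * z ^ n)"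
    by (auto simp: c_def)
  ultimately show "(\<lambda>n. c n * z ^ n) sums (1 - (1 - z) powr r)" by simp
next
  show "continuous_on {0..1} (\<lambda>z. 1 - (1 - z) powr r)"
    using assms by (intro continuous_intros continuous_on_powr') auto
qed (use assms in auto)

lemma has_integral_arctan:
  fixes x :: real
  assumes "0 < x"
  shows "((\<lambda>u. 1 / (1 + x\<^sup>2 * u\<^sup>2)) has_integral arctan x / x) {0..1}"
proof -
  have "((\<lambda>u. 1 / (1 + x\<^sup>2 * u\<^sup>2)) has_integral (arctan (x * 1) / x - arctan (x * 0) / x)) {0..1}"
  proof (rule fundamental_theorem_of_calculus)
    fix u :: real
    have "((\<lambda>u. arctan (x * u) / x) has_real_derivative 1 / (1 + x\<^sup>2 * u\<^sup>2)) (at u within {0..1})"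
      using assms by (auto intro!: derivative_eq_intros simp: power_mult_distrib divide_inverse)
    then show "((\<lambda>u. arctan (x * u) / x) has_vector_derivative 1 / (1 + x\<^sup>2 * u\<^sup>2)) (at u within {0..1})"
      by (simp add: has_real_derivative_iff_has_vector_derivative)
  qed auto
  then show ?thesis by simp
qed

lemma tendsto_arctan_over_self: "((\<lambda>x::real. arctan x / x) \<longlongrightarrow> 1) (at 0)"
  using DERIV_arctan[of 0] by (simp add: has_field_derivative_iff)

text \<open>
  With \<open>x\<^sup>2 = a * (1 - z)\<close> the integrand of \<open>arctan x / x\<close>, the integral over \<open>u\<close> in
  \<open>[0,1]\<close> of \<open>1 / (1 + x\<^sup>2 * u\<^sup>2)\<close>, is the generating function of a geometric distribution,
  with ratio \<open>v = a * u\<^sup>2 / (1 + a * u\<^sup>2)\<close>. Hence the function is a mixture of such generating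
  functions. The series is integrated termwise with an explicit remainder, bounded by \<open>z ^ N\<close>.
  The value at \<open>z = 1\<close> is the limit, which division by zero would not give.
\<close>

lemma is_pgf_arctan:
  fixes a :: real
  assumes a: "0 < a"
  shows "is_pgf (\<lambda>z. if z = 1 then 1 else arctan (sqrt (a * (1 - z))) / sqrt (a * (1 - z)))"
    (is "is_pgf ?G")
proof (rule is_pgf_power_series)
  define v where "v u = a * u\<^sup>2 / (1 + a * u\<^sup>2)" for u
  have pos: "0 < 1 + a * u\<^sup>2" for u
    using a by (simp add: add_pos_nonneg)
  have v: "0 \<le> v u" "v u < 1" for u
    using a pos[of u] by (auto simp: v_def)
  have contv: "continuous_on {0..1} v"
    unfolding v_def using pos by (intro continuous_intros) (metis less_irrefl)
  define c where "c n = integral {0..1} (\<lambda>u. (1 - v u) * v u ^ n)" for n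
  have int: "((\<lambda>u. (1 - v u) * v u ^ n) has_integral c n) {0..1}" for n
    unfolding c_def
    by (intro integrable_integral integrable_continuous_real continuous_intros contv)
  show "0 \<le> c n" for n
    using v by (intro has_integral_nonneg[OF int]) (simp add: less_imp_le)
  fix z :: real
  assume z: "0 \<le> z" "z < 1"
  define x where "x = sqrt (a * (1 - z))"
  have x: "0 < x" "x\<^sup>2 = a * (1 - z)" using z a by (auto simp: x_def)
  have vz: "v u * z < 1" for u
    using v[of u] z mult_left_le[of z "v u"] by linarith
  have integrand: "1 / (1 + x\<^sup>2 * u\<^sup>2) = (1 - v u) / (1 - v u * z)" for u
  proof -
    have "1 - v u = 1 / (1 + a * u\<^sup>2)" using pos[of u] by (simp add: v_def field_simps)
    moreover have "1 - v u * z = (1 + x\<^sup>2 * u\<^sup>2) / (1 + a * u\<^sup>2)"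
      using pos[of u] by (simp add: v_def x field_simps)
    ultimately show ?thesis using pos[of u] by simp
  qed
  have remainder: "\<bar>arctan x / x - (\<Sum>n<N. c n * z ^ n)\<bar> \<le> z ^ N" for N
  proof -
    have "((\<lambda>u. 1 / (1 + x\<^sup>2 * u\<^sup>2) - (\<Sum>n<N. (1 - v u) * v u ^ n * z ^ n)) has_integral
        (arctan x / x - (\<Sum>n<N. c n * z ^ n))) {0..1}"
      by (intro has_integral_diff has_integral_arctan x has_integral_sum has_integral_mult_left int) auto
    moreover have "norm (1 / (1 + x\<^sup>2 * u\<^sup>2) - (\<Sum>n<N. (1 - v u) * v u ^ n * z ^ n)) \<le> z ^ N" for u
    proof -
      have "(\<Sum>n<N. (1 - v u) * v u ^ n * z ^ n) = (1 - v u) * (\<Sum>n<N. (v u * z) ^ n)"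
        by (simp add: sum_distrib_left power_mult_distrib mult.assoc)
      also have "\<dots> = (1 - v u) * ((1 - (v u * z) ^ N) / (1 - v u * z))"
        using vz[of u] by (subst sum_gp_strict) auto
      finally have "1 / (1 + x\<^sup>2 * u\<^sup>2) - (\<Sum>n<N. (1 - v u) * v u ^ n * z ^ n) =
          (1 - v u) / (1 - v u * z) * (v u * z) ^ N"
        using vz[of u] unfolding integrand by (simp add: field_simps)
      moreover have "\<bar>(1 - v u) / (1 - v u * z)\<bar> \<le> 1"
        using v[of u] z vz[of u] mult_left_le[of z "v u"] by simp
      moreover have "\<bar>(v u * z) ^ N\<bar> \<le> z ^ N"
        using v[of u] z mult_left_le_one_le[of z "v u"] by (simp add: power_mono)
      ultimately show ?thesis
        using mult_mono[of "\<bar>(1 - v u) / (1 - v u * z)\<bar>" 1 "\<bar>(v u * z) ^ N\<bar>" "z ^ N"]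
        by (simp add: abs_mult)
    qed
    ultimately have "norm (arctan x / x - (\<Sum>n<N. c n * z ^ n)) \<le> z ^ N * measure lborel {0..1::real}"
      using z by (intro has_integral_bound_real[of "z ^ N" "{}"]) auto
    then show ?thesis by simp
  qed
  have "(\<lambda>N. z ^ N) \<longlonglongrightarrow> 0"
    using z by (intro LIMSEQ_realpow_zero) auto
  then have "(\<lambda>N. arctan x / x - (\<Sum>n<N. c n * z ^ n)) \<longlonglongrightarrow> 0"
    by (rule Lim_null_comparison[OF always_eventually, rotated])
      (simp only: real_norm_def remainder simp_thms)
  then have "(\<lambda>N. arctan x / x - (arctan x / x - (\<Sum>n<N. c n * z ^ n))) \<longlonglongrightarrow> arctan x / x - 0"
    by (rule tendsto_diff[OF tendsto_const])
  then show "(\<lambda>n. c n * z ^ n) sums ?G z"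
    using z unfolding sums_def by (simp add: x_def)
next
  show "continuous_on {0..1} ?G"
    unfolding continuous_on_def
  proof
    fix z :: real
    assume z: "z \<in> {0..1}"
    show "(?G \<longlongrightarrow> ?G z) (at z within {0..1})"
    proof (cases "z = 1")
      case True
      have "filterlim (\<lambda>z. sqrt (a * (1 - z))) (at 0) (at 1 within {0..1})"
        unfolding filterlim_at using a
        by (auto intro!: tendsto_eq_intros simp: eventually_at_filter)
      from filterlim_compose[OF tendsto_arctan_over_self this]
      have "((\<lambda>z. arctan (sqrt (a * (1 - z))) / sqrt (a * (1 - z))) \<longlongrightarrow> 1) (at 1 within {0..1})" .
      then show ?thesis
        using True by (auto elim!: Lim_transform_eventually simp: eventually_at_filter)
    next
      case False
      have "((\<lambda>z. arctan (sqrt (a * (1 - z))) / sqrt (a * (1 - z))) \<longlongrightarrow> ?G z) (at z within {0..1})"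
        using False a by (auto intro!: tendsto_eq_intros)
      moreover have "\<forall>\<^sub>F w in at z within {0..1}. w \<noteq> 1"
        by (rule eventually_neq_at_within)
      ultimately show ?thesis
        by (elim Lim_transform_eventually) (auto elim: eventually_mono)
    qed
  qed
qed auto

text \<open>
  Termwise integration divides the coefficients by positive numbers, so the power series of the
  derivative passes to \<open>F\<close> with its signs. The derivative is prescribed only inside the unit
  interval, where \<open>K\<close> agrees with its power series; continuity at \<open>0\<close>
  fixes the constant of integration and continuity at \<open>1\<close> the total mass.
\<close>

lemma is_pgf_antiderivative:
  fixes F K :: "real \<Rightarrow> real"
  assumes K: "is_pgf K" and C: "0 \<le> C"
    and deriv: "\<And>z. 0 < z \<Longrightarrow> z < 1 \<Longrightarrow> (F has_real_derivative C * K z) (at z)"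
    and cont: "continuous_on {0..1} F" and F0: "F 0 = 0" and F1: "F 1 = 1"
  shows "is_pgf F"
proof -
  obtain k where k: "\<And>z. z \<in> {0..1} \<Longrightarrow> pgf k z = K z"
    using K unfolding is_pgf_def by blast
  define e where "e n = C * pmf k n / real (Suc n)" for n
  have e: "e n * real (Suc n) = C * pmf k n" for n by (simp add: e_def)
  define E where "E z = (\<Sum>n. e n * z ^ Suc n)" for z
  have sumk: "summable (\<lambda>n. C * pmf k n * z ^ n)" if "z \<in> {-1<..<1}" for z
  proof (rule summable_comparison_test)
    show "\<exists>N. \<forall>n\<ge>N. norm (C * pmf k n * z ^ n) \<le> C * (pmf k n * \<bar>z\<bar> ^ n)"
      using C by (auto simp: abs_mult power_abs)
    show "summable (\<lambda>n. C * (pmf k n * \<bar>z\<bar> ^ n))"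
      using that by (intro summable_mult sums_summable[OF pgf_sums]) auto
  qed
  have dE: "(E has_real_derivative (\<Sum>n. C * pmf k n * z ^ n)) (at z)" if "z \<in> {-1<..<1}" for z
    unfolding E_def e[symmetric]
    using that by (intro DERIV_power_series'[of 1]) (auto simp: sumk e simp del: of_nat_Suc)
  have E: "E z = F z" if z: "0 \<le> z" "z < 1" for z
  proof (cases "z = 0")
    case False
    have "F z - E z = F 0 - E 0"
    proof (rule DERIV_isconst_end[where f = "\<lambda>z. F z - E z"])
      have "continuous_on {0..z} E"
        using z by (intro DERIV_continuous_on[OF has_field_derivative_at_within[OF dE]]) auto
      then show "continuous_on {0..z} (\<lambda>z. F z - E z)"
        using z by (intro continuous_intros continuous_on_subset[OF cont]) auto
      fix w assume w: "0 < w" "w < z"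
      have "(\<lambda>n. C * (pmf k n * w ^ n)) sums (C * K w)"
        using w z k[of w] pgf_sums[of w k] by (intro sums_mult) auto
      then have "(E has_real_derivative C * K w) (at w)"
        using dE[of w] w z by (simp add: sums_iff mult.assoc)
      then show "((\<lambda>z. F z - E z) has_real_derivative 0) (at w)"
        using DERIV_diff[OF deriv[of w], of E "C * K w"] w z by simp
    qed (use z False in auto)
    then show ?thesis by (simp add: F0 E_def)
  qed (simp add: F0 E_def)
  show ?thesis
  proof (rule is_pgf_power_series[where c = "\<lambda>n. if n = 0 then 0 else e (n - 1)"])
    show "0 \<le> (if n = 0 then 0 else e (n - 1))" for n
      using C by (simp add: e_def)
    fix z :: real
    assume z: "0 \<le> z" "z < 1"
    have "summable (\<lambda>n. e n * z ^ Suc n)"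
    proof (rule summable_comparison_test)
      have "e n * z ^ Suc n \<le> C * (pmf k n * z ^ n)" for n
      proof -
        have "e n * z ^ Suc n = C * (pmf k n * z ^ n) * (z / real (Suc n))"
          by (simp add: e_def)
        also have "\<dots> \<le> C * (pmf k n * z ^ n)"
          using z C by (intro mult_left_le) (auto simp: divide_simps)
        finally show ?thesis .
      qed
      moreover have "0 \<le> e n * z ^ Suc n" for n using z C by (simp add: e_def)
      ultimately show "\<exists>N. \<forall>n\<ge>N. norm (e n * z ^ Suc n) \<le> C * (pmf k n * z ^ n)"
        by (metis real_norm_def abs_of_nonneg)
      show "summable (\<lambda>n. C * (pmf k n * z ^ n))"
        using z by (intro summable_mult sums_summable[OF pgf_sums]) auto
    qed
    then have "(\<lambda>n. e n * z ^ Suc n) sums F z"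
      using E[OF z] by (metis E_def summable_sums)
    then show "(\<lambda>n. (if n = 0 then 0 else e (n - 1)) * z ^ n) sums F z"
      using sums_Suc_iff[of "\<lambda>n. (if n = 0 then 0 else e (n - 1)) * z ^ n" "F z"] by simp
  qed (use cont F1 in auto)
qed

text \<open>
  With \<open>t = a * (1 - z)\<close>, the derivative of \<open>(arctan (sqrt t))\<^sup>2\<close> with respect to \<open>t\<close> is
  the product of \<open>arctan (sqrt t) / sqrt t\<close> and \<open>1 / (1 + t)\<close>. As functions of \<open>z\<close> the first
  factor is a generating function, and so is the second up to a constant: it belongs to the
  geometric law with ratio \<open>a / (1 + a)\<close>.
\<close>

lemma is_pgf_arctan_squared:
  fixes a :: real
  assumes a: "0 < a"
  shows "is_pgf (\<lambda>z. 1 - (arctan (sqrt (a * (1 - z))))\<^sup>2 / (arctan (sqrt a))\<^sup>2)"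
    (is "is_pgf ?F")
proof -
  define h where "h = (arctan (sqrt a))\<^sup>2"
  have h: "0 < h" using a by (simp add: h_def)
  define c where "c = a / (1 + a)"
  have c: "0 \<le> c" "c < 1" using a by (auto simp: c_def)
  define G where "G z = (if z = 1 then 1 else arctan (sqrt (a * (1 - z))) / sqrt (a * (1 - z)))" for z
  have "is_pgf (\<lambda>z. G z * ((1 - c) / (1 - c * z)))"
    unfolding G_def by (intro is_pgf_mult is_pgf_arctan is_pgf_geometric a c)
  then show ?thesis
  proof (rule is_pgf_antiderivative[where C = "a / h"])
    fix z :: real
    assume z: "0 < z" "z < 1"
    define x where "x = sqrt (a * (1 - z))"
    have x: "0 < x" "x\<^sup>2 = a * (1 - z)" using z a by (auto simp: x_def)
    have p: "0 < 1 + a * (1 - z)" using a z by (simp add: add_pos_pos)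
    have d: "((\<lambda>z. sqrt (a * (1 - z))) has_real_derivative - a / (2 * x)) (at z)"
    proof -
      have "((\<lambda>z. a * (1 - z)) has_real_derivative - a) (at z)"
        by (auto intro!: derivative_eq_intros)
      moreover have "0 < a * (1 - z)" using a z by simp
      ultimately have "((\<lambda>z. sqrt (a * (1 - z))) has_real_derivative
          inverse (sqrt (a * (1 - z))) / 2 * - a) (at z)"
        by (intro DERIV_chain2[OF DERIV_real_sqrt])
      also have "inverse (sqrt (a * (1 - z))) / 2 * - a = - a / (2 * x)"
        using x(1) unfolding x_def[symmetric] by (simp add: field_simps)
      finally show ?thesis .
    qed
    have "((\<lambda>z. arctan (sqrt (a * (1 - z)))) has_real_derivative
        inverse (1 + (sqrt (a * (1 - z)))\<^sup>2) * (- a / (2 * x))) (at z)"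
      by (rule DERIV_chain2[OF DERIV_arctan d])
    also have "inverse (1 + (sqrt (a * (1 - z)))\<^sup>2) * (- a / (2 * x)) = - a / (2 * x * (1 + a * (1 - z)))"
      using x p unfolding x_def[symmetric] by (simp only: x(2) divide_inverse inverse_mult_distrib mult_ac)
    finally have arctan_deriv: "((\<lambda>z. arctan (sqrt (a * (1 - z)))) has_real_derivative
        - a / (2 * x * (1 + a * (1 - z)))) (at z)" .
    have "((\<lambda>z. 1 - (arctan (sqrt (a * (1 - z))))\<^sup>2 / h) has_real_derivative
        - (2 * arctan x * (- a / (2 * x * (1 + a * (1 - z)))) / h)) (at z)"
      using DERIV_diff[OF DERIV_const DERIV_cdivide[OF DERIV_power[OF arctan_deriv, of 2], of h], of 1]
      by (simp add: mult_ac flip: x_def)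
    moreover have "a / h * (G z * ((1 - c) / (1 - c * z))) =
        - (2 * arctan x * (- a / (2 * x * (1 + a * (1 - z)))) / h)"
    proof -
      have "1 - c = 1 / (1 + a)" "1 - c * z = (1 + a * (1 - z)) / (1 + a)"
        using a by (auto simp: c_def field_simps)
      then have "(1 - c) / (1 - c * z) = 1 / (1 + a * (1 - z))" using a p by simp
      moreover have "G z = arctan x / x" using z by (simp add: G_def x_def)
      moreover have "a / h * (t / x * (1 / w)) = - (2 * t * (- a / (2 * x * w)) / h)" for t w
        by (simp add: mult_ac)
      ultimately show ?thesis by (simp only:)
    qed
    ultimately show "(?F has_real_derivative a / h * (G z * ((1 - c) / (1 - c * z)))) (at z)"
      by (simp only: h_def)
  next
    show "continuous_on {0..1} ?F"
      using h unfolding h_def by (intro continuous_intros) auto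
  qed (use h a in \<open>auto simp: h_def\<close>)
qed

section \<open>Existence and uniqueness of the laws\<close>

abbreviation TPDS_angle :: "real \<Rightarrow> real \<Rightarrow> real" where
  "TPDS_angle b z \<equiv> arccos (((1 + b) * z - 2 * b) / (2 - (1 + b) * z))"

text \<open>
  The tangent half-angle substitution turns the fractional linear argument of the arccosine into
  an affine function of \<open>z\<close>.
\<close>

lemma TPDS_angle_eq_arctan:
  fixes b z :: real
  assumes b: "-1 < b" "b < 1" and z: "z \<in> {0..1}"
  shows "TPDS_angle b z
    = 2 * arctan (sqrt ((1 + b) / (1 - b) * (1 - z)))"
proof -
  define x where "x = sqrt ((1 + b) / (1 - b) * (1 - z))"
  have x: "0 \<le> x" "x\<^sup>2 = (1 + b) / (1 - b) * (1 - z)" using b z by (auto simp: x_def)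
  have den: "0 < 2 - (1 + b) * z"
  proof -
    have "(1 + b) * z \<le> 1 + b" using b z by (intro mult_left_le) auto
    then show ?thesis using b by linarith
  qed
  have "cos (2 * arctan x) = (1 - x\<^sup>2) / (1 + x\<^sup>2)"
  proof -
    have "0 < 1 + x\<^sup>2" by (simp add: add_pos_nonneg)
    moreover have "(cos (arctan x))\<^sup>2 = 1 / (1 + x\<^sup>2)"
      by (simp add: cos_arctan power_divide)
    ultimately show ?thesis unfolding cos_double_cos by (simp add: field_simps)
  qed
  also have "1 - x\<^sup>2 = ((1 + b) * z - 2 * b) / (1 - b)"
    using b by (simp add: x field_simps)
  also have "1 + x\<^sup>2 = (2 - (1 + b) * z) / (1 - b)"
    using b by (simp add: x field_simps)
  finally have "((1 + b) * z - 2 * b) / (2 - (1 + b) * z) = cos (2 * arctan x)"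
    using b by simp
  moreover have "arccos (cos (2 * arctan x)) = 2 * arctan x"
    using x arctan_ubound[of x] by (intro arccos_cos) auto
  ultimately show ?thesis by (simp add: x_def)
qed

text \<open>
  Up to a constant factor the \<open>g\<close>-th power of the angle is \<open>(1 - y) powr (g / 2)\<close>, where
  \<open>y\<close> is the generating function built from the squared arctangent. This is
  \<open>1 - s(y)\<close> with \<open>s\<close> the generating function of Sibuya's law, which exists because
  \<open>g / 2 \<le> 1\<close>; the exponential then makes it a compound Poisson law.
\<close>

lemma is_pgf_TPDS:
  fixes g l b :: real
  assumes g: "0 < g" "g \<le> 2" and l: "0 \<le> l" and b: "-1 < b" "b < 1"
  shows "is_pgf (\<lambda>z. exp (- l * TPDS_angle b z powr g))"
proof -
  define a where "a = (1 + b) / (1 - b)"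
  have a: "0 < a" using b by (simp add: a_def)
  define h where "h = (arctan (sqrt a))\<^sup>2"
  have h: "0 < h" using a by (simp add: h_def)
  define y where "y z = 1 - (arctan (sqrt (a * (1 - z))))\<^sup>2 / h" for z
  have y: "is_pgf y" unfolding y_def h_def by (rule is_pgf_arctan_squared[OF a])
  (* chosen because the squared angle is \<open>4 * h * (1 - y z)\<close> *)
  define r where "r = l * (4 * h) powr (g / 2)"
  have "is_pgf (\<lambda>z. exp (- r * (1 - (1 - (1 - y z) powr (g / 2)))))"
    using g l by (intro is_pgf_compose[OF is_pgf_exp is_pgf_compose[OF is_pgf_sibuya y]])
      (auto simp: r_def)
  then show ?thesis
  proof (rule is_pgf_cong)
    fix z :: real
    assume z: "z \<in> {0..1}"
    define t where "t = arctan (sqrt (a * (1 - z)))"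
    have t: "0 \<le> t" using a z by (simp add: t_def)
    have "(4 * h) powr (g / 2) * (1 - y z) powr (g / 2) = (4 * t\<^sup>2) powr (g / 2)"
      using h by (simp add: y_def t_def flip: powr_mult)
    also have "4 * t\<^sup>2 = (2 * t) powr 2"
      using t by (simp add: power_mult_distrib)
    also have "\<dots> powr (g / 2) = (2 * t) powr g"
      by (simp add: powr_powr)
    also have "2 * t = TPDS_angle b z"
      using TPDS_angle_eq_arctan[OF b z] by (simp add: t_def a_def)
    finally show "exp (- r * (1 - (1 - (1 - y z) powr (g / 2)))) = exp (- l * TPDS_angle b z powr g)"
      by (simp add: r_def mult.assoc)
  qed
qed

lemma TPDS_eqI:
  assumes "\<And>z. z \<in> {0..1} \<Longrightarrow> pgf p z = exp (- l * TPDS_angle b z powr g)"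
  shows "TPDS g l b = p"
  unfolding TPDS_def using assms by (intro the_equality pmf_eqI_pgf) auto

lemma pgf_TPDS:
  fixes g l b :: real
  assumes "0 < g" "g \<le> 2" "0 \<le> l" "-1 < b" "b < 1" "z \<in> {0..1}"
  shows "pgf (TPDS g l b) z = exp (- l * TPDS_angle b z powr g)"
proof -
  obtain p where p: "\<And>z. z \<in> {0..1} \<Longrightarrow> pgf p z = exp (- l * TPDS_angle b z powr g)"
    using is_pgf_TPDS[of g l b] assms unfolding is_pgf_def by blast
  with TPDS_eqI[of p l b g] assms(6) show ?thesis by simp
qed

lemma TPDS_angle_pos:
  fixes b z :: real
  assumes "-1 < b" "b < 1" "0 \<le> z" "z < 1"
  shows "0 < TPDS_angle b z"
  using assms by (subst TPDS_angle_eq_arctan) auto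

text \<open>
  For a negative rate the required value at \<open>0\<close> exceeds one, so that no distribution has the
  required generating function and the definite description denotes one fixed default.
\<close>

lemma TPDS_negative_rate:
  fixes g l b :: real
  assumes "-1 < b" "b < 1" "l < 0"
  shows "TPDS g l b = TPDS g (-1) b"
proof -
  have no: "\<not> (\<forall>z\<in>{0..1}. pgf p z = exp (- k * TPDS_angle b z powr g))" if "k < 0" for k p
  proof
    assume "\<forall>z\<in>{0..1}. pgf p z = exp (- k * TPDS_angle b z powr g)"
    then have "pgf p 0 = exp (- k * TPDS_angle b 0 powr g)"
      by (rule bspec) simp
    moreover have "0 < - k * TPDS_angle b 0 powr g"
      using TPDS_angle_pos[OF assms(1,2), of 0] that by (intro mult_pos_pos) simp_all
    ultimately have "1 < pgf p 0" by (simp only: one_less_exp_iff)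
    then show False using pgf_le_1[of 0 p] by simp
  qed
  have "(\<lambda>p. \<forall>z\<in>{0..1}. pgf p z = exp (- l * TPDS_angle b z powr g))
      = (\<lambda>p. \<forall>z\<in>{0..1}. pgf p z = exp (- (-1) * TPDS_angle b z powr g))"
    using no[OF \<open>l < 0\<close>] no[of "-1"] by (intro ext) (simp only:)
  then show ?thesis unfolding TPDS_def by (rule arg_cong)
qed

text \<open>
  Measurability must hold on all of the space, not just almost everywhere, since \<open>\<bind>\<close>
  is meaningful only for a measurable kernel. Negative values of \<open>L\<close> cause no harm because
  they all give the same default distribution.
\<close>

lemma measurable_pgf_TPDS:
  fixes g b :: real
  assumes g: "0 < g" "g \<le> 2" and b: "-1 < b" "b < 1" and L: "L \<in> borel_measurable M"
    and z: "z \<in> {0..1}"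
  shows "(\<lambda>\<omega>. pgf (TPDS g (L \<omega>) b) z) \<in> borel_measurable M"
proof -
  have "pgf (TPDS g (L \<omega>) b) z =
      (if L \<omega> < 0 then pgf (TPDS g (-1) b) z else exp (- L \<omega> * TPDS_angle b z powr g))" for \<omega>
    using pgf_TPDS[OF g _ b z, of "L \<omega>"] TPDS_negative_rate[OF b, of "L \<omega>" g] by auto
  then show ?thesis using L by simp
qed

section \<open>Mixing over a stable rate\<close>

lemma pmf_of_prob_measure:
  fixes Q :: "nat measure"
  assumes "prob_space Q" and sets: "sets Q = UNIV"
  obtains q where "measure_pmf q = Q"
proof -
  interpret prob_space Q by fact
  have "AE n in Q. measure Q {n} \<noteq> 0"
    using AE_support_countable[OF sets] by (blast intro: AE_I2)
  then show thesis
    using that[of "Abs_pmf Q"] assms by (simp add: Abs_pmf_inverse)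
qed

theorem theorem6p2:
  fixes M :: "'a measure" and S :: "'a \<Rightarrow> real" and \<gamma> \<gamma>' l b :: real
  assumes "0 < \<gamma>'" "\<gamma>' \<le> 2"
    and "0 < \<gamma>" "\<gamma> \<le> 1"
    and "\<gamma>' \<le> 2 * \<gamma>"
    and "0 < l"
    and "-1 < b" "b < 1"
    and "prob_space M"
    and "S \<in> borel_measurable M"
    and "AE \<omega> in M. 0 < S \<omega>"
    and "\<And>u. 0 \<le> u \<Longrightarrow> (\<integral>\<omega>. exp (- u * S \<omega>) \<partial>M) = exp (- (u powr \<gamma>))"
  shows "measure_pmf (TPDS \<gamma>' l b) =
         TPDS_mixture M (\<gamma>' / \<gamma>) (\<lambda>\<omega>. l powr (1 / \<gamma>) * S \<omega>) b"
proof -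
  interpret prob_space M by fact
  note b = \<open>-1 < b\<close> \<open>b < 1\<close>
  note [measurable] = \<open>S \<in> borel_measurable M\<close>
  define g where "g = \<gamma>' / \<gamma>"
  have g: "0 < g" "g \<le> 2" using assms(1-5) by (auto simp: g_def field_simps)
  define L where "L \<omega> = l powr (1 / \<gamma>) * S \<omega>" for \<omega>
  have L: "L \<in> borel_measurable M" unfolding L_def by measurable
  have pos: "AE \<omega> in M. 0 < L \<omega>"
    using assms(11) by eventually_elim (use \<open>0 < l\<close> in \<open>simp add: L_def\<close>)
  define P where "P \<omega> = TPDS g (L \<omega>) b" for \<omega>
  have kernel: "(\<lambda>\<omega>. measure_pmf (P \<omega>)) \<in> measurable M (subprob_algebra (count_space UNIV))"
    unfolding P_def by (intro measurable_pmf_kernel measurable_pgf_TPDS g b L)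
  define Q where "Q = M \<bind> (\<lambda>\<omega>. measure_pmf (P \<omega>))"
  have setsQ: "sets Q = UNIV"
    unfolding Q_def using not_empty by (subst sets_bind[where N = "count_space UNIV"]) auto
  have "prob_space Q"
    unfolding Q_def
    by (rule prob_space_bind[OF _ kernel]) (auto intro: measure_pmf.prob_space_axioms)
  then obtain q where q: "measure_pmf q = Q"
    using pmf_of_prob_measure setsQ by blast
  have "TPDS \<gamma>' l b = q"
  proof (rule TPDS_eqI)
    fix z :: real
    assume z: "z \<in> {0..1}"
    define \<theta> where "\<theta> = TPDS_angle b z"
    have \<theta>: "0 \<le> \<theta>" unfolding \<theta>_def using b z by (subst TPDS_angle_eq_arctan) auto
    (* the Laplace variable for which \<open>u * S \<omega>\<close> is \<open>L \<omega> * \<theta> powr g\<close> *)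
    define u where "u = l powr (1 / \<gamma>) * \<theta> powr g"
    have exponent: "u powr \<gamma> = l * \<theta> powr \<gamma>'"
      using assms(1-6) by (simp add: u_def g_def powr_mult powr_powr)
    have "ennreal (pgf q z) = (\<integral>\<^sup>+\<omega>. ennreal (pgf (P \<omega>) z) \<partial>M)"
      using z unfolding pgf_nn_integral[OF z] q Q_def
      by (subst nn_integral_bind[OF _ kernel]) auto
    also have "\<dots> = (\<integral>\<^sup>+\<omega>. ennreal (exp (- u * S \<omega>)) \<partial>M)"
    proof (rule nn_integral_cong_AE)
      show "AE \<omega> in M. ennreal (pgf (P \<omega>) z) = ennreal (exp (- u * S \<omega>))"
        using pos
      proof eventually_elim
        case (elim \<omega>)
        then have "pgf (P \<omega>) z = exp (- L \<omega> * \<theta> powr g)"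
          unfolding P_def \<theta>_def using g b z by (intro pgf_TPDS) auto
        also have "- L \<omega> * \<theta> powr g = - u * S \<omega>" by (simp add: L_def u_def)
        finally show ?case by simp
      qed
    qed
    also have "\<dots> = ennreal (\<integral>\<omega>. exp (- u * S \<omega>) \<partial>M)"
    proof (rule nn_integral_eq_integral)
      show "integrable M (\<lambda>\<omega>. exp (- u * S \<omega>))"
        using assms(11)
        by (intro integrable_const_bound[where B = 1]) (auto simp: u_def elim!: eventually_mono)
    qed auto
    also have "\<dots> = ennreal (exp (- l * \<theta> powr \<gamma>'))"
      using assms(12)[of u] exponent by (simp add: u_def)
    finally show "pgf q z = exp (- l * \<theta> powr \<gamma>')"
      using pgf_nonneg[OF z, of q] by simp
  qed
  then show ?thesis
    by (simp add: TPDS_mixture_def q Q_def P_def L_def g_def)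
qed

end
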